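(* Let $\mathbb{F}$ be a field, let $\epsilon,\eta\ge0$ and $p,m\ge1$ be integers, let $\lambda M_1+M_0\in\mathbb{F}[\lambda]^{(\eta+1)p\times(\epsilon+1)m}$ be an arbitrary pencil, and let $$C_K(\lambda)=\begin{bmatrix}\lambda M_1+M_0&L_\eta(\lambda)^T\otimes I_p\\ L_\epsilon(\lambda)\otimes I_m&0\end{bmatrix}$$ be the corresponding block Kronecker pencil. Let $$P(\lambda):=(\Lambda_\eta(\lambda)^T\otimes I_p)(\lambda M_1+M_0)(\Lambda_\epsilon(\lambda)\otimes I_m)\in\mathbb{F}[\lambda]^{p\times m}.$$ Partition $L_\epsilon(\lambda)\otimes I_m=\begin{bmatrix}A_{\epsilon,m}(\lambda)&B_{\epsilon,m}(\lambda)\end{bmatrix}$ and $L_\eta(\lambda)\otimes I_p=\begin{bmatrix}A_{\eta,p}(\lambda)&B_{\eta,p}(\lambda)\end{bmatrix}$, where $A_{\epsilon,m}(\lambda)$ is $\epsilon m\times\epsilon m$ and $A_{\eta,p}(\lambda)$ is $\eta p\times\eta p$, and correspondingly $$C_K(\lambda)=\begin{bmatrix}M_{11}(\lambda)&M_{12}(\lambda)&A_{\eta,p}(\lambda)^T\\ M_{21}(\lambda)&M_{22}(\lambda)&B_{\eta,p}(\lambda)^T\\ A_{\epsilon,m}(\lambda)&B_{\epsilon,m}(\lambda)&0\end{bmatrix},$$ where $M_{11}(\lambda)$ is $\eta p\times\epsilon m$ and $M_{22}(\lambda)$ is $p\times m$. Then the following statements hold: (a) The submatrix $A(\lambda):=\begin{bmatrix}M_{11}(\lambda)&A_{\eta,p}(\lambda)^T\\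 A_{\epsilon,m}(\lambda)&0\end{bmatrix}$ of $C_K(\lambda)$ is unimodular. (b) The Schur complement of $A(\lambda)$ in $C_K(\lambda)$, i.e. $D(\lambda)+C(\lambda)A(\lambda)^{-1}B(\lambda)$ with $B(\lambda):=\begin{bmatrix}M_{12}(\lambda)\\ B_{\epsilon,m}(\lambda)\end{bmatrix}$, $C(\lambda):=-\begin{bmatrix}M_{21}(\lambda)&B_{\eta,p}(\lambda)^T\end{bmatrix}$ and $D(\lambda):=M_{22}(\lambda)$, is the polynomial matrix $P(\lambda)$. (c) $C_K(\lambda)$ is a linearization of $P(\lambda)$.
   Context: $\mathbb{F}$ is an arbitrary field; $\otimes$ is the Kronecker product. A pencil is a polynomial matrix of degree at most $1$. A unimodular matrix is a square polynomial matrix whose determinant is a nonzero constant. For $k\ge0$, $$L_k(\lambda):=\begin{bmatrix}-1&\lambda\\ &-1&\lambda\\ &&\ddots&\ddots\\ &&&-1&\lambda\end{bmatrix}\in\mathbb{F}[\lambda]^{k\times(k+1)},\qquad\Lambda_k(\lambda):=\begin{bmatrix}\lambda^k&\lambda^{k-1}&\cdots&\lambda&1\end{bmatrix}^T.$$ The cases $\epsilon=0$ or $\eta=0$ (second block row, respectively second block column, of $C_K(\lambda)$ empty) are included; the corresponding blocks are then empty. A linearization of $P(\lambda)\in\mathbb{F}[\lambda]^{p\times m}$ is a pencil $L(\lambda)$ for which there exist unimodular matrices $U_1(\lambda),V_1(\lambda)$ and an integer $s\ge0$ with $U_1(\lambda)L(\lambda)V_1(\lambda)=\begin{bmatrix}P(\lambda)&0\\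 0&I_s\end{bmatrix}$. *)

theory Defs
  imports "Jordan_Normal_Form.Determinant"
begin

definition kronecker :: "'a :: semiring_1 mat \<Rightarrow> 'a mat \<Rightarrow> 'a mat" (infixl "\<otimes>\<^sub>K" 75) where
  "A \<otimes>\<^sub>K B = mat (dim_row A * dim_row B) (dim_col A * dim_col B)
     (\<lambda>(i, j). A $$ (i div dim_row B, j div dim_col B) * B $$ (i mod dim_row B, j mod dim_col B))"

text \<open>Column counterpart of the library's \<open>@\<^sub>r\<close>: the block row \<open>[A B]\<close>.\<close>

definition append_cols :: "'a :: zero mat \<Rightarrow> 'a mat \<Rightarrow> 'a mat" (infixr "@\<^sub>c" 66) where
  "A @\<^sub>c B = four_block_mat A B (0\<^sub>m 0 (dim_col A)) (0\<^sub>m 0 (dim_col B))"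

text \<open>A polynomial matrix is a matrix over \<open>'a poly\<close>; the indeterminate is \<open>[:0, 1:]\<close>.\<close>

definition is_pencil :: "'a :: zero poly mat \<Rightarrow> bool" where
  "is_pencil L \<longleftrightarrow> (\<forall>i < dim_row L. \<forall>j < dim_col L. degree (L $$ (i, j)) \<le> 1)"

definition unimodular :: "'a :: field poly mat \<Rightarrow> bool" where
  "unimodular U \<longleftrightarrow> square_mat U \<and> (\<exists>c. c \<noteq> 0 \<and> det U = [:c:])"

text \<open>The product of matrices does not check that inner dimensions agree, so the sizes of the
  transformation matrices are fixed explicitly.\<close>

definition is_linearization :: "'a :: field poly mat \<Rightarrow> 'a poly mat \<Rightarrow> bool" where
  "is_linearization L P \<longleftrightarrow> is_pencil L \<and>
     (\<exists>U V s. U \<in> carrier_mat (dim_row L) (dim_row L) \<and> unimodular U \<and>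
              V \<in> carrier_mat (dim_col L) (dim_col L) \<and> unimodular V \<and>
              U * L * V = four_block_mat P (0\<^sub>m (dim_row P) s) (0\<^sub>m s (dim_col P)) (1\<^sub>m s))"

definition L_pencil :: "nat \<Rightarrow> 'a :: field poly mat" where
  "L_pencil k = mat k (k + 1)
     (\<lambda>(i, j). if j = i then - 1 else if j = i + 1 then [:0, 1:] else 0)"

definition Lambda_vec :: "nat \<Rightarrow> 'a :: field poly mat" where
  "Lambda_vec k = mat (k + 1) 1 (\<lambda>(i, _). [:0, 1:] ^ (k - i))"

definition pencil :: "'a :: field mat \<Rightarrow> 'a mat \<Rightarrow> 'a poly mat" where
  "pencil M1 M0 = [:0, 1:] \<cdot>\<^sub>m map_mat (\<lambda>a. [:a:]) M1 + map_mat (\<lambda>a. [:a:]) M0"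

definition block_kronecker_pencil ::
    "nat \<Rightarrow> nat \<Rightarrow> nat \<Rightarrow> nat \<Rightarrow> 'a :: field mat \<Rightarrow> 'a mat \<Rightarrow> 'a poly mat" where
  "block_kronecker_pencil \<epsilon> \<eta> p m M1 M0 =
     four_block_mat (pencil M1 M0)                ((L_pencil \<eta>)\<^sup>T \<otimes>\<^sub>K 1\<^sub>m p)
                    (L_pencil \<epsilon> \<otimes>\<^sub>K 1\<^sub>m m)  (0\<^sub>m (\<epsilon> * m) (\<eta> * p))"

definition block_kronecker_poly ::
    "nat \<Rightarrow> nat \<Rightarrow> nat \<Rightarrow> nat \<Rightarrow> 'a :: field mat \<Rightarrow> 'a mat \<Rightarrow> 'a poly mat" where
  "block_kronecker_poly \<epsilon> \<eta> p m M1 M0 =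
     ((Lambda_vec \<eta>)\<^sup>T \<otimes>\<^sub>K 1\<^sub>m p) * pencil M1 M0 * (Lambda_vec \<epsilon> \<otimes>\<^sub>K 1\<^sub>m m)"

text \<open>Two-sided inverse over an arbitrary ring (the library's \<open>mat_inverse\<close> needs a field).
  It is unique when it exists, and unspecified unless \<open>invertible_mat A\<close>.\<close>

definition inverse_of_mat :: "'a :: semiring_1 mat \<Rightarrow> 'a mat" where
  "inverse_of_mat A = (THE X. inverts_mat A X \<and> inverts_mat X A)"

text \<open>Sign convention: this is the Schur complement of \<open>A\<close> in \<open>[A B; -C D]\<close>.\<close>

definition schur_complement :: "'a :: ring_1 mat \<Rightarrow> 'a mat \<Rightarrow> 'a mat \<Rightarrow> 'a mat \<Rightarrow> 'a mat" where
  "schur_complement A B C D = D + C * inverse_of_mat A * B"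

end

theory Submission
  imports Defs
begin

text \<open>
  The corner block \<open>A\<^sub>\<epsilon>\<close> of \<open>L\<^sub>\<epsilon> \<otimes> I\<^sub>m\<close> is upper triangular with \<open>-1\<close> on the diagonal, so it has a
  polynomial inverse, and so does \<open>A\<^sub>\<eta>\<^sup>T\<close>. Since the lower right block of \<open>A\<close> vanishes, \<open>A\<close> is
  anti-triangular with these two invertible blocks off the diagonal, whatever \<open>M\<^sub>1\<^sub>1\<close> is. This gives
  a polynomial inverse of \<open>A\<close> (\<open>L_kronecker_left_block_inverse\<close>,
  \<open>anti_triangular_block_inverse\<close>), and a polynomial matrix with a polynomial inverse is
  unimodular because its determinant divides \<open>1\<close>.

  The Schur complement is found without computing \<open>A\<^sup>-\<^sup>1\<close>. The last block of \<open>\<Lambda>\<^sub>\<epsilon> \<otimes> I\<^sub>m\<close> is an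
  identity; let \<open>X\<close> be the part above it, and let \<open>Y\<close> be the corresponding part of
  \<open>\<Lambda>\<^sub>\<eta> \<otimes> I\<^sub>p\<close>. From \<open>L\<^sub>k \<Lambda>\<^sub>k = 0\<close> and the mixed product rule, \<open>A\<^sub>\<epsilon> X + B\<^sub>\<epsilon> = 0\<close> and
  \<open>A\<^sub>\<eta> Y + B\<^sub>\<eta> = 0\<close> (\<open>L_kronecker_annihilates\<close>). Put \<open>N = M\<^sub>1\<^sub>1 X + M\<^sub>1\<^sub>2\<close> and
  \<open>W = A\<^sub>\<eta>\<^sup>-\<^sup>T N\<close>. Then the column with blocks \<open>-X\<close> and \<open>W\<close> solves \<open>A Z = B\<close>, and
  \<open>B\<^sub>\<eta>\<^sup>T W = - Y\<^sup>T A\<^sub>\<eta>\<^sup>T W = - Y\<^sup>T N\<close>, so that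
  \<open>D + C Z = M\<^sub>2\<^sub>2 + M\<^sub>2\<^sub>1 X + Y\<^sup>T N\<close>. Expanding \<open>P\<close> blockwise gives the same matrix.

  For the linearization, block permutations bring the middle block row and block column of
  \<open>C\<^sub>K\<close> to the front, which turns it into \<open>[D -C; B A]\<close> (\<open>middle_block_to_front\<close>). As \<open>A\<close> has a
  polynomial inverse, block elimination with unimodular matrices reduces this to
  \<open>[P 0; 0 I]\<close> (\<open>schur_reduction\<close>).
\<close>

section \<open>Unimodular matrices and inverses\<close>

text \<open>The determinants of \<open>A\<close> and \<open>B\<close> multiply to \<open>1\<close>, and the units among the polynomials over a
  field are the nonzero constants.\<close>

lemma unimodular_if_right_inverse:
  assumes A: "A \<in> carrier_mat n n" and B: "B \<in> carrier_mat n n" and AB: "A * B = 1\<^sub>m n"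
  shows "unimodular A"
proof -
  have "det A * det B = 1" using det_mult[OF A B] AB by simp
  then have "is_unit (det A)" by (metis dvd_triv_left)
  then show ?thesis using A by (auto simp: unimodular_def is_unit_poly_iff)
qed

lemma unimodular_mult:
  assumes U: "U \<in> carrier_mat n n" "unimodular U" and V: "V \<in> carrier_mat n n" "unimodular V"
  shows "unimodular (U * V)"
proof -
  obtain c d where "c \<noteq> 0" "det U = [:c:]" "d \<noteq> 0" "det V = [:d:]"
    using U V by (auto simp: unimodular_def)
  then have "det (U * V) = [:c * d:]" "c * d \<noteq> 0"
    using det_mult[OF U(1) V(1)] by simp_all
  then show ?thesis using U V by (auto simp: unimodular_def)
qed

lemma inverse_of_mat_eq:
  assumes A: "A \<in> carrier_mat n n" and A': "A' \<in> carrier_mat n n"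
    and AA': "A * A' = 1\<^sub>m n" and A'A: "A' * A = 1\<^sub>m n"
  shows "inverse_of_mat A = A'"
  unfolding inverse_of_mat_def
proof (rule the_equality)
  show "inverts_mat A A' \<and> inverts_mat A' A"
    using A A' AA' A'A by (simp add: inverts_mat_def)
next
  fix X assume X: "inverts_mat A X \<and> inverts_mat X A"
  then have AX: "A * X = 1\<^sub>m n" and XA: "X * A = 1\<^sub>m (dim_row X)"
    using A by (auto simp: inverts_mat_def)
  have "dim_col X = n" using arg_cong[OF AX, of dim_col] by simp
  moreover have "dim_row X = n" using arg_cong[OF XA, of dim_col] A by simp
  ultimately have Xc: "X \<in> carrier_mat n n" by auto
  have "X = (A' * A) * X" using A'A Xc by simp
  also have "\<dots> = A' * (A * X)" using A A' Xc by (simp add: assoc_mult_mat)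
  also have "\<dots> = A'" using AX A' by simp
  finally show "X = A'" .
qed

text \<open>Here \<open>det A = (-1)\<^sup>n\<close> is its own inverse, so \<open>det A\<close> times the adjugate inverts \<open>A\<close> over
  the base ring, without passing to a field of fractions.\<close>

lemma upper_triangular_minus_one_diag_inverse:
  fixes A :: "'a :: idom mat"
  assumes A: "A \<in> carrier_mat n n" and ut: "upper_triangular A"
    and diag: "\<And>i. i < n \<Longrightarrow> A $$ (i, i) = - 1"
  obtains A' where "A' \<in> carrier_mat n n" "A * A' = 1\<^sub>m n" "A' * A = 1\<^sub>m n"
proof -
  have "diag_mat A = map (\<lambda>i. - 1) [0..<n]"
    using A diag by (auto simp: diag_mat_def)
  then have "det A = (- 1) ^ n"
    using det_upper_triangular[OF ut A] by (simp add: map_replicate_const)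
  then have d: "det A * det A = 1"
    by (simp flip: power_add mult_2)
  note adj = adj_mat[OF A]
  let ?A' = "det A \<cdot>\<^sub>m adj_mat A"
  show ?thesis
  proof
    show "?A' \<in> carrier_mat n n" using adj(1) by simp
    show "A * ?A' = 1\<^sub>m n"
      using mult_smult_distrib[OF A adj(1)] adj(2) d by (auto intro!: eq_matI)
    show "?A' * A = 1\<^sub>m n"
      using mult_smult_assoc_mat[OF adj(1) A] adj(3) d by (auto intro!: eq_matI)
  qed
qed

lemma add_uminus_self_mat:
  "A \<in> carrier_mat n m \<Longrightarrow> A + (- A) = (0\<^sub>m n m :: 'a :: group_add mat)"
  by (auto intro!: eq_matI)

lemma uminus_zero_mat: "- 0\<^sub>m n m = (0\<^sub>m n m :: 'a :: group_add mat)"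
  by (auto intro!: eq_matI)

text \<open>The matrix \<open>[M E; F 0]\<close> is inverted by \<open>[0 F'; E' -E'MF']\<close>: solving
  \<open>F x = v\<close> for \<open>x\<close> first and then \<open>M x + E y = u\<close> for \<open>y\<close> only inverts \<open>E\<close> and \<open>F\<close>. The block
  \<open>M\<close> may be rectangular.\<close>

lemma anti_triangular_block_inverse:
  fixes M :: "'a :: comm_ring_1 mat"
  assumes M: "M \<in> carrier_mat a b"
    and E: "E \<in> carrier_mat a a" "E' \<in> carrier_mat a a" "E * E' = 1\<^sub>m a" "E' * E = 1\<^sub>m a"
    and F: "F \<in> carrier_mat b b" "F' \<in> carrier_mat b b" "F * F' = 1\<^sub>m b" "F' * F = 1\<^sub>m b"
  defines "A \<equiv> four_block_mat M E F (0\<^sub>m b a)"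
    and "A' \<equiv> four_block_mat (0\<^sub>m b a) F' E' (- (E' * M * F'))"
  shows "A' \<in> carrier_mat (a + b) (a + b)" "A * A' = 1\<^sub>m (a + b)" "A' * A = 1\<^sub>m (a + b)"
proof -
  show "A' \<in> carrier_mat (a + b) (a + b)" using E F M by (auto simp: A'_def)
  have "E * (- (E' * M * F')) = - (E * (E' * M * F'))" using E F M by simp
  also have "E * (E' * M * F') = (E * E') * (M * F')"
    using E(1,2) F(2) M by (simp add: assoc_mult_mat[of _ a a _ b _ b] assoc_mult_mat[of _ a a _ a _ b])
  finally have "M * F' + E * (- (E' * M * F')) = 0\<^sub>m a b"
    using E F M by (simp add: add_uminus_self_mat[of _ a b])
  then show "A * A' = 1\<^sub>m (a + b)"
    unfolding A_def A'_def using E F M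
    by (subst mult_four_block_mat[of _ a b _ a _ b _ _ a _ b]) (auto simp: uminus_zero_mat)
  have "E' * M * F' * F = E' * M * (F' * F)"
    using E F M by (intro assoc_mult_mat) auto
  also have "\<dots> = E' * M" using E F M by simp
  finally have "E' * M * F' * F = E' * M" .
  moreover have "(- (E' * M * F')) * F = - (E' * M * F' * F)"
    using E F M by (intro uminus_mult_left_mat) auto
  ultimately have "E' * M + (- (E' * M * F')) * F = 0\<^sub>m a b"
    using E F M by (simp add: add_uminus_self_mat[of _ a b])
  then show "A' * A = 1\<^sub>m (a + b)"
    unfolding A_def A'_def using E F M
    by (subst mult_four_block_mat[of _ b a _ b _ a _ _ b _ a]) (auto simp: add.commute)
qed

section \<open>Kronecker products\<close>

lemma kronecker_carrier [simp, intro]: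
  "A \<in> carrier_mat a b \<Longrightarrow> B \<in> carrier_mat c d \<Longrightarrow> A \<otimes>\<^sub>K B \<in> carrier_mat (a * c) (b * d)"
  by (auto simp: kronecker_def)

lemma kronecker_dims [simp]:
  "dim_row (A \<otimes>\<^sub>K B) = dim_row A * dim_row B" "dim_col (A \<otimes>\<^sub>K B) = dim_col A * dim_col B"
  by (simp_all add: kronecker_def)

lemma div_mod_less:
  fixes i a b :: nat
  assumes "i < a * b" shows "i div b < a" "i mod b < b"
  using assms by (auto simp: less_mult_imp_div_less intro!: mod_less_divisor gr0I)

lemma kronecker_transpose: "(A \<otimes>\<^sub>K B)\<^sup>T = A\<^sup>T \<otimes>\<^sub>K B\<^sup>T"
  by (rule eq_matI) (auto simp: kronecker_def div_mod_less)

text \<open>The map \<open>k \<mapsto> (k div d, k mod d)\<close> is how Kronecker products number pairs of indices;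
  summing over \<open>k\<close> is summing over the pairs.\<close>

lemma sum_div_mod:
  fixes g :: "nat \<Rightarrow> nat \<Rightarrow> 'a :: comm_monoid_add"
  shows "(\<Sum>k = 0..<b * d. g (k div d) (k mod d)) = (\<Sum>i = 0..<b. \<Sum>j = 0..<d. g i j)"
proof -
  have "(\<Sum>k = i * d..<i * d + d. g (k div d) (k mod d)) = (\<Sum>j = 0..<d. g i j)" for i
    using sum.shift_bounds_nat_ivl[of "\<lambda>k. g (k div d) (k mod d)" 0 "i * d" d]
    by (simp add: add.commute)
  then show ?thesis
    using sum.nat_group[of "\<lambda>k. g (k div d) (k mod d)" d b]
    by (simp add: atLeast0LessThan)
qed

text \<open>After pairing the summation index, each entry of the left-hand side is a double sum that
  factors, because entries commute, into an entry of \<open>A C\<close> times an entry of \<open>B D\<close>.\<close>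

lemma kronecker_mixed_product:
  fixes A B C D :: "'a :: comm_semiring_1 mat"
  assumes "A \<in> carrier_mat a b" "B \<in> carrier_mat c d" "C \<in> carrier_mat b e" "D \<in> carrier_mat d f"
  shows "(A \<otimes>\<^sub>K B) * (C \<otimes>\<^sub>K D) = (A * C) \<otimes>\<^sub>K (B * D)"
proof (rule eq_matI)
  fix i j assume "i < dim_row ((A * C) \<otimes>\<^sub>K (B * D))" "j < dim_col ((A * C) \<otimes>\<^sub>K (B * D))"
  then have ij: "i < a * c" "j < e * f" using assms by auto
  let ?g = "\<lambda>k l. A $$ (i div c, k) * B $$ (i mod c, l) * (C $$ (k, j div f) * D $$ (l, j mod f))"
  have "((A \<otimes>\<^sub>K B) * (C \<otimes>\<^sub>K D)) $$ (i, j) = (\<Sum>k = 0..<b * d. ?g (k div d) (k mod d))"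
    using ij assms by (auto simp: kronecker_def scalar_prod_def intro!: sum.cong)
  also have "\<dots> = (\<Sum>k = 0..<b. \<Sum>l = 0..<d. ?g k l)" by (rule sum_div_mod)
  also have "\<dots> = (\<Sum>k = 0..<b. A $$ (i div c, k) * C $$ (k, j div f)) *
                    (\<Sum>l = 0..<d. B $$ (i mod c, l) * D $$ (l, j mod f))"
    by (simp add: sum_product mult_ac)
  also have "\<dots> = ((A * C) \<otimes>\<^sub>K (B * D)) $$ (i, j)"
    using ij assms by (auto simp: kronecker_def scalar_prod_def div_mod_less)
  finally show "((A \<otimes>\<^sub>K B) * (C \<otimes>\<^sub>K D)) $$ (i, j) = ((A * C) \<otimes>\<^sub>K (B * D)) $$ (i, j)" .
qed (use assms in auto)

section \<open>Block rows and block columns\<close>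

lemma append_cols_carrier [simp, intro]:
  "A \<in> carrier_mat n a \<Longrightarrow> B \<in> carrier_mat n b \<Longrightarrow> A @\<^sub>c B \<in> carrier_mat n (a + b)"
  by (auto simp: append_cols_def)

lemma append_cols_index:
  assumes "A \<in> carrier_mat n a" "B \<in> carrier_mat n b" "i < n" "j < a + b"
  shows "(A @\<^sub>c B) $$ (i, j) = (if j < a then A $$ (i, j) else B $$ (i, j - a))"
  using assms by (auto simp: append_cols_def)

lemma append_rows_index:
  assumes "A \<in> carrier_mat a n" "B \<in> carrier_mat b n" "i < a + b" "j < n"
  shows "(A @\<^sub>r B) $$ (i, j) = (if i < a then A $$ (i, j) else B $$ (i - a, j))"
  using assms by (auto simp: append_rows_def)

lemma append_rows_transpose:
  assumes "A \<in> carrier_mat a n" "B \<in> carrier_mat b n"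
  shows "(A @\<^sub>r B)\<^sup>T = A\<^sup>T @\<^sub>c B\<^sup>T"
  using assms by (auto simp: append_rows_def append_cols_def intro!: eq_matI)

text \<open>Block rows and block columns are four-block matrices with empty blocks. Products
  of them are again four-block matrices, whose empty blocks this lemma removes.\<close>

lemma four_block_empty:
  assumes "A \<in> carrier_mat n m" "B \<in> carrier_mat n 0" "C \<in> carrier_mat 0 m" "D \<in> carrier_mat 0 0"
  shows "four_block_mat A B C D = A"
  using assms by (auto intro!: eq_matI)

lemma append_cols_mult_append_rows:
  fixes E :: "'a :: semiring_0 mat"
  assumes "E \<in> carrier_mat n a" "F \<in> carrier_mat n b" "G \<in> carrier_mat a m" "H \<in> carrier_mat b m"
  shows "(E @\<^sub>c F) * (G @\<^sub>r H) = E * G + F * H"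
  unfolding append_cols_def append_rows_def using assms
  by (subst mult_four_block_mat[of _ n a _ b _ 0 _ _ m _ 0]) (auto intro!: four_block_empty)

lemma four_block_mult_append_rows:
  fixes M11 :: "'a :: semiring_0 mat"
  assumes "M11 \<in> carrier_mat a c" "M12 \<in> carrier_mat a d" "M21 \<in> carrier_mat b c"
    "M22 \<in> carrier_mat b d" "X \<in> carrier_mat c m" "Z \<in> carrier_mat d m"
  shows "four_block_mat M11 M12 M21 M22 * (X @\<^sub>r Z)
    = (M11 * X + M12 * Z) @\<^sub>r (M21 * X + M22 * Z)"
  unfolding append_rows_def using assms
  by (subst mult_four_block_mat[of _ a c _ d _ b _ _ m _ 0]) (auto intro!: cong_four_block_mat)

lemma append_cols_mult_four_block:
  fixes M11 :: "'a :: semiring_0 mat"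
  assumes "M11 \<in> carrier_mat a c" "M12 \<in> carrier_mat a d" "M21 \<in> carrier_mat b c"
    "M22 \<in> carrier_mat b d" "X \<in> carrier_mat m a" "Z \<in> carrier_mat m b"
  shows "(X @\<^sub>c Z) * four_block_mat M11 M12 M21 M22
    = (X * M11 + Z * M21) @\<^sub>c (X * M12 + Z * M22)"
  unfolding append_cols_def using assms
  by (subst mult_four_block_mat[of _ m a _ b _ 0 _ _ c _ d]) (auto intro!: cong_four_block_mat)

section \<open>The blocks of a block Kronecker pencil\<close>

lemma L_pencil_carrier: "L_pencil k \<in> carrier_mat k (k + 1)"
  by (simp add: L_pencil_def)

lemma Lambda_vec_carrier: "Lambda_vec k \<in> carrier_mat (k + 1) 1"
  by (simp add: Lambda_vec_def)

text \<open>Row \<open>i\<close> of the product is \<open>-\<lambda>\<^bsup>k-i\<^esup> + \<lambda> \<lambda>\<^bsup>k-i-1\<^esup> = 0\<close>.\<close>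

lemma L_pencil_mult_Lambda_vec:
  "L_pencil k * Lambda_vec k = (0\<^sub>m k 1 :: 'a :: field poly mat)"
proof (rule eq_matI)
  fix i j assume "i < dim_row (0\<^sub>m k 1 :: 'a poly mat)" "j < dim_col (0\<^sub>m k 1 :: 'a poly mat)"
  then have i: "i < k" and j: "j = 0" by auto
  let ?x = "[:0, 1:] :: 'a poly"
  have "(L_pencil k * Lambda_vec k) $$ (i, j)
      = (\<Sum>l = 0..<k + 1. (if l = i then - 1 else if l = i + 1 then ?x else 0) * ?x ^ (k - l))"
    using i j by (auto simp: L_pencil_def Lambda_vec_def scalar_prod_def intro!: sum.cong)
  also have "\<dots> = (\<Sum>l \<in> {i, i + 1}. (if l = i then - 1 else if l = i + 1 then ?x else 0) * ?x ^ (k - l))"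
    using i by (intro sum.mono_neutral_right) auto
  also have "\<dots> = - (?x ^ (k - i)) + ?x * ?x ^ (k - (i + 1))" by simp
  also have "\<dots> = 0" using i by (simp flip: power_Suc add: Suc_diff_Suc)
  finally show "(L_pencil k * Lambda_vec k) $$ (i, j) = (0\<^sub>m k 1 :: 'a poly mat) $$ (i, j)" using i j by simp
qed (simp_all add: L_pencil_def Lambda_vec_def)

text \<open>The last entry of \<open>\<Lambda>\<^sub>k\<close> is \<open>\<lambda>\<^sup>0 = 1\<close>, so the last block of the Kronecker product is an
  identity.\<close>

lemma Lambda_kronecker_split:
  obtains X :: "'a :: field poly mat" where "X \<in> carrier_mat (k * m) m"
    "Lambda_vec k \<otimes>\<^sub>K 1\<^sub>m m = X @\<^sub>r 1\<^sub>m m"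
proof
  let ?L = "Lambda_vec k \<otimes>\<^sub>K 1\<^sub>m m :: 'a poly mat"
  let ?X = "mat (k * m) m (\<lambda>(i, j). ?L $$ (i, j))"
  show "?X \<in> carrier_mat (k * m) m" by simp
  show "?L = ?X @\<^sub>r 1\<^sub>m m"
  proof (rule eq_matI)
    fix i j assume "i < dim_row (?X @\<^sub>r 1\<^sub>m m)" "j < dim_col (?X @\<^sub>r 1\<^sub>m m)"
    then have ij: "i < k * m + m" "j < m" by (auto simp: append_rows_def)
    show "?L $$ (i, j) = (?X @\<^sub>r 1\<^sub>m m) $$ (i, j)"
    proof (cases "i < k * m")
      case True
      then show ?thesis using ij by (simp add: append_rows_index[of _ "k * m" m _ m])
    next
      case False
      then obtain r where r: "i = k * m + r" "r < m"
        using ij by (metis add_less_cancel_left le_Suc_ex not_less)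
      then show ?thesis using ij
        by (simp add: append_rows_index[of _ "k * m" m _ m] kronecker_def Lambda_vec_def)
    qed
  qed (auto simp: append_rows_def Lambda_vec_def)
qed

text \<open>This is \<open>(L\<^sub>k \<otimes> I)(\<Lambda>\<^sub>k \<otimes> I) = L\<^sub>k \<Lambda>\<^sub>k \<otimes> I = 0\<close>, written in blocks as \<open>A X + B I = 0\<close>.\<close>

lemma L_kronecker_annihilates:
  fixes A B X :: "'a :: field poly mat"
  assumes A: "A \<in> carrier_mat (k * m) (k * m)" and B: "B \<in> carrier_mat (k * m) m"
    and LAB: "L_pencil k \<otimes>\<^sub>K 1\<^sub>m m = A @\<^sub>c B"
    and X: "X \<in> carrier_mat (k * m) m" and LX: "Lambda_vec k \<otimes>\<^sub>K 1\<^sub>m m = X @\<^sub>r 1\<^sub>m m"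
  shows "A * (- X) = B"
proof -
  have "A * X + B = (A @\<^sub>c B) * (X @\<^sub>r 1\<^sub>m m)"
    using A B X by (simp add: append_cols_mult_append_rows)
  also have "\<dots> = (L_pencil k * Lambda_vec k) \<otimes>\<^sub>K (1\<^sub>m m * 1\<^sub>m m)"
    unfolding LAB[symmetric] LX[symmetric]
    by (rule kronecker_mixed_product[of _ k "k + 1" _ m m _ 1 _ m])
      (simp_all add: L_pencil_carrier Lambda_vec_carrier del: One_nat_def add_Suc_right)
  also have "\<dots> = 0\<^sub>m (k * m) m"
    by (auto simp: L_pencil_mult_Lambda_vec kronecker_def div_mod_less intro!: eq_matI)
  finally have eq: "A * X + B = 0\<^sub>m (k * m) m" .
  show ?thesis
  proof (rule eq_matI)
    fix i j assume "i < dim_row B" "j < dim_col B"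
    then show "(A * (- X)) $$ (i, j) = B $$ (i, j)"
      using arg_cong[OF eq, of "\<lambda>M. M $$ (i, j)"] A B X
      by (simp add: add_eq_0_iff)
  qed (use A B X in auto)
qed

text \<open>Dropping the last block column of \<open>L\<^sub>k \<otimes> I\<close> leaves the diagonal blocks \<open>-I\<close> and the
  superdiagonal blocks \<open>\<lambda> I\<close>, hence an upper triangular matrix.\<close>

lemma L_kronecker_left_block_inverse:
  fixes A B :: "'a :: field poly mat"
  assumes A: "A \<in> carrier_mat (k * m) (k * m)" and B: "B \<in> carrier_mat (k * m) m"
    and LAB: "L_pencil k \<otimes>\<^sub>K 1\<^sub>m m = A @\<^sub>c B"
  obtains A' where "A' \<in> carrier_mat (k * m) (k * m)" "A * A' = 1\<^sub>m (k * m)" "A' * A = 1\<^sub>m (k * m)"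
proof (rule upper_triangular_minus_one_diag_inverse[OF A])
  have entry: "A $$ (i, j) = (if j div m = i div m then - 1 else if j div m = i div m + 1 then [:0, 1:] else 0)
      * (if i mod m = j mod m then 1 else 0)" if "i < k * m" "j < k * m" for i j
  proof -
    have "A $$ (i, j) = (A @\<^sub>c B) $$ (i, j)"
      using that A B by (simp add: append_cols_index)
    also have "\<dots> = (L_pencil k \<otimes>\<^sub>K 1\<^sub>m m) $$ (i, j)" by (simp add: LAB)
    finally show ?thesis using that div_mod_less[OF that(1)] div_mod_less[OF that(2)]
      by (simp add: kronecker_def L_pencil_def)
  qed
  show "A $$ (i, i) = - 1" if "i < k * m" for i using that by (simp add: entry)
  show "upper_triangular A"
  proof
    fix i j assume ji: "j < i" and "i < dim_row A"
    then have lt: "i < k * m" "j < k * m" using A by auto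
    have "j div m \<le> i div m" using ji by (simp add: div_le_mono)
    moreover have "\<not> (j div m = i div m \<and> j mod m = i mod m)"
      using ji by (metis div_mult_mod_eq less_irrefl)
    ultimately show "A $$ (i, j) = 0" using entry[OF lt] by auto
  qed
qed (use that in blast)

lemma block_kronecker_pencil_is_pencil:
  fixes M1 M0 :: "'a :: field mat"
  assumes "M1 \<in> carrier_mat ((\<eta> + 1) * p) ((\<epsilon> + 1) * m)"
    and "M0 \<in> carrier_mat ((\<eta> + 1) * p) ((\<epsilon> + 1) * m)"
  shows "is_pencil (block_kronecker_pencil \<epsilon> \<eta> p m M1 M0)"
proof -
  have pencil: "degree (pencil M1 M0 $$ (i, j)) \<le> 1"
    if "i < (\<eta> + 1) * p" "j < (\<epsilon> + 1) * m" for i j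
    using that assms by (simp add: pencil_def)
  have L: "degree ((L_pencil k \<otimes>\<^sub>K 1\<^sub>m n :: 'a poly mat) $$ (i, j)) \<le> 1"
    if "i < k * n" "j < (k + 1) * n" for k n i j
    using div_mod_less[OF that(1)] div_mod_less[OF that(2)] that by (simp add: kronecker_def L_pencil_def)
  have LT: "(L_pencil \<eta>)\<^sup>T \<otimes>\<^sub>K 1\<^sub>m p = (L_pencil \<eta> \<otimes>\<^sub>K 1\<^sub>m p)\<^sup>T"
    by (simp add: kronecker_transpose transpose_one)
  have c: "pencil M1 M0 \<in> carrier_mat ((\<eta> + 1) * p) ((\<epsilon> + 1) * m)"
    using assms by (auto simp: pencil_def)
  have d: "dim_row (L_pencil k) = k" "dim_col (L_pencil k) = k + 1" for k
    by (simp_all add: L_pencil_def)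
  have shift: "i - a < b" if "i < a + b" "\<not> i < a" for i a b :: nat using that by simp
  show ?thesis
    unfolding is_pencil_def block_kronecker_pencil_def LT
    using c by (auto simp: d intro!: pencil L shift simp del: One_nat_def mult_Suc add_Suc_right)
qed

section \<open>Schur complements\<close>

text \<open>Any solution of \<open>A Z = B\<close> is \<open>A\<^sup>-\<^sup>1 B\<close>. Solving this system is easier than handling the
  inverse of the block matrix \<open>A\<close>.\<close>

lemma schur_complement_by_solution:
  fixes A :: "'a :: comm_ring_1 mat"
  assumes A: "A \<in> carrier_mat n n" "A' \<in> carrier_mat n n" "A * A' = 1\<^sub>m n" "A' * A = 1\<^sub>m n"
    and C: "C \<in> carrier_mat p n" and Z: "Z \<in> carrier_mat n m" and AZ: "A * Z = B"
  shows "schur_complement A B C D = D + C * Z"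
proof -
  have "C * A' * (A * Z) = C * (A' * (A * Z))"
    using A C Z by (intro assoc_mult_mat) auto
  also have "A' * (A * Z) = (A' * A) * Z"
    using A(1,2) Z by (intro assoc_mult_mat[symmetric]) auto
  also have "C * (A' * A * Z) = C * Z" using A(4) Z by simp
  finally show ?thesis by (simp add: schur_complement_def inverse_of_mat_eq[OF A] AZ)
qed

text \<open>Block elimination: adding \<open>C A\<^sup>-\<^sup>1\<close> times the second block row to the first clears \<open>-C\<close> and
  produces the Schur complement; a column operation then clears \<open>B\<close> and turns \<open>A\<close> into the
  identity. Both operations are polynomial because \<open>A\<^sup>-\<^sup>1\<close> is.\<close>

lemma schur_reduction:
  fixes A :: "'a :: field poly mat"
  assumes A: "A \<in> carrier_mat n n" "A' \<in> carrier_mat n n" "A * A' = 1\<^sub>m n" "A' * A = 1\<^sub>m n"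
    and B: "B \<in> carrier_mat n m" and C: "C \<in> carrier_mat p n" and D: "D \<in> carrier_mat p m"
  obtains U V where "U \<in> carrier_mat (p + n) (p + n)" "unimodular U"
    "V \<in> carrier_mat (m + n) (m + n)" "unimodular V"
    "U * four_block_mat D (- C) B A * V
      = four_block_mat (schur_complement A B C D) (0\<^sub>m p n) (0\<^sub>m n m) (1\<^sub>m n)"
proof
  let ?U = "four_block_mat (1\<^sub>m p) (C * A') (0\<^sub>m n p) (1\<^sub>m n)"
  let ?U' = "four_block_mat (1\<^sub>m p) (- (C * A')) (0\<^sub>m n p) (1\<^sub>m n)"
  let ?V = "four_block_mat (1\<^sub>m m) (0\<^sub>m m n) (- (A' * B)) A'"
  let ?V' = "four_block_mat (1\<^sub>m m) (0\<^sub>m m n) B A"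
  let ?P = "schur_complement A B C D"
  have P: "?P = D + C * A' * B" by (simp add: schur_complement_def inverse_of_mat_eq[OF A])
  have Pc: "?P \<in> carrier_mat p m" using A B C D unfolding P by auto
  show U: "?U \<in> carrier_mat (p + n) (p + n)" using A C by auto
  show V: "?V \<in> carrier_mat (m + n) (m + n)" using A B by auto
  have "?U * ?U' = 1\<^sub>m (p + n)"
    using A C by (subst mult_four_block_mat[of _ p p _ n _ n _ _ p _ n])
      (auto simp: add_uminus_self_mat[of _ p n] uminus_zero_mat uminus_l_inv_mat[of _ p n])
  then show "unimodular ?U" using U A C by (intro unimodular_if_right_inverse[of _ "p + n" ?U']) auto
  have "?V * ?V' = 1\<^sub>m (m + n)"
    using A B by (subst mult_four_block_mat[of _ m m _ n _ n _ _ m _ n])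
      (auto simp: uminus_l_inv_mat[of _ n m])
  then show "unimodular ?V" using V A B by (intro unimodular_if_right_inverse[of _ "m + n" ?V']) auto
  have "C * A' * A = C"
    using A C by (simp add: assoc_mult_mat[of _ p n _ n _ n])
  then have UL: "?U * four_block_mat D (- C) B A = four_block_mat ?P (0\<^sub>m p n) B A"
    using A B C D unfolding P
    by (subst mult_four_block_mat[of _ p p _ n _ n _ _ m _ n]) auto
  have "A * (A' * B) = B"
    using A B by (simp flip: assoc_mult_mat[of _ n n _ n _ m])
  then have "four_block_mat ?P (0\<^sub>m p n) B A * ?V = four_block_mat ?P (0\<^sub>m p n) (0\<^sub>m n m) (1\<^sub>m n)"
    using A B Pc by (subst mult_four_block_mat[of _ p m _ n _ n _ _ m _ n]) auto
  then show "?U * four_block_mat D (- C) B A * ?V = four_block_mat ?P (0\<^sub>m p n) (0\<^sub>m n m) (1\<^sub>m n)"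
    using UL by simp
qed

text \<open>This is the permutation matrix that exchanges the first two blocks. Its inverse is the
  exchange with the block sizes interchanged.\<close>

lemma swap_unimodular:
  fixes a b n
  defines "S \<equiv> four_block_mat (four_block_mat (0\<^sub>m a b) (1\<^sub>m a) (1\<^sub>m b) (0\<^sub>m b a))
    (0\<^sub>m (a + b) n) (0\<^sub>m n (b + a)) (1\<^sub>m n) :: 'a :: field poly mat"
  shows "S \<in> carrier_mat (a + b + n) (a + b + n)" "unimodular S"
proof -
  let ?T = "four_block_mat (four_block_mat (0\<^sub>m b a) (1\<^sub>m b) (1\<^sub>m a) (0\<^sub>m a b))
    (0\<^sub>m (b + a) n) (0\<^sub>m n (a + b)) (1\<^sub>m n) :: 'a poly mat"
  have "four_block_mat (0\<^sub>m a b) (1\<^sub>m a) (1\<^sub>m b) (0\<^sub>m b a)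
      * four_block_mat (0\<^sub>m b a) (1\<^sub>m b) (1\<^sub>m a) (0\<^sub>m a b) = (1\<^sub>m (a + b) :: 'a poly mat)"
    by (subst mult_four_block_mat[of _ a b _ a _ b _ _ a _ b]) auto
  then have "S * ?T = 1\<^sub>m (a + b + n)"
    unfolding S_def
    by (subst mult_four_block_mat[of _ "a + b" "b + a" _ n _ n _ _ "a + b" _ n]) auto
  moreover show "S \<in> carrier_mat (a + b + n) (a + b + n)" by (auto simp: S_def)
  ultimately show "unimodular S" by (intro unimodular_if_right_inverse[of _ "a + b + n" ?T]) auto
qed

text \<open>Exchanging the first two block rows and the first two block columns moves the \<open>p \<times> m\<close> block
  \<open>M\<^sub>2\<^sub>2\<close> to the upper left corner and gathers the four corner blocks of the original
  matrix in the lower right one.\<close>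

lemma middle_block_to_front:
  fixes M11 :: "'a :: field poly mat"
  assumes M: "M11 \<in> carrier_mat a b" "M12 \<in> carrier_mat a m" "M21 \<in> carrier_mat p b" "M22 \<in> carrier_mat p m"
    and E: "E \<in> carrier_mat a a" "F \<in> carrier_mat p a" and G: "G \<in> carrier_mat b b" "H \<in> carrier_mat b m"
  obtains U V where "U \<in> carrier_mat (p + (a + b)) (p + (a + b))" "unimodular U"
    "V \<in> carrier_mat (m + (a + b)) (m + (a + b))" "unimodular V"
    "U * ((M11 @\<^sub>c M12 @\<^sub>c E) @\<^sub>r (M21 @\<^sub>c M22 @\<^sub>c F) @\<^sub>r (G @\<^sub>c H @\<^sub>c 0\<^sub>m b a)) * V
      = four_block_mat M22 (M21 @\<^sub>c F) (M12 @\<^sub>r H) (four_block_mat M11 E G (0\<^sub>m b a))"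
proof
  let ?S = "four_block_mat (0\<^sub>m p a) (1\<^sub>m p) (1\<^sub>m a) (0\<^sub>m a p) :: 'a poly mat"
  let ?T = "four_block_mat (0\<^sub>m b m) (1\<^sub>m b) (1\<^sub>m m) (0\<^sub>m m b) :: 'a poly mat"
  let ?U = "four_block_mat ?S (0\<^sub>m (p + a) b) (0\<^sub>m b (a + p)) (1\<^sub>m b)"
  let ?V = "four_block_mat ?T (0\<^sub>m (b + m) a) (0\<^sub>m a (m + b)) (1\<^sub>m a)"
  let ?M = "four_block_mat M11 M12 M21 M22"
  let ?M' = "four_block_mat M22 M21 M12 M11"
  \<comment> \<open>The products below are computed on the \<open>2 \<times> 2\<close> partition whose first block row and first block
    column each collect two of the three.\<close>
  have L: "(M11 @\<^sub>c M12 @\<^sub>c E) @\<^sub>r (M21 @\<^sub>c M22 @\<^sub>c F) @\<^sub>r (G @\<^sub>c H @\<^sub>c 0\<^sub>m b a)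
      = four_block_mat ?M (E @\<^sub>r F) (G @\<^sub>c H) (0\<^sub>m b a)"
    using M E G by (intro eq_matI) (auto simp: append_rows_def append_cols_def)
  have c: "E @\<^sub>r F \<in> carrier_mat (a + p) a" "F @\<^sub>r E \<in> carrier_mat (p + a) a"
    "G @\<^sub>c H \<in> carrier_mat b (b + m)" "H @\<^sub>c G \<in> carrier_mat b (m + b)"
    using E G by auto
  note c0 = left_mult_zero_mat[OF c(1)] left_mult_zero_mat[OF c(3)] left_mult_one_mat[OF c(3)]
    right_mult_zero_mat[OF c(2)] right_mult_zero_mat[OF c(3)] right_mult_one_mat[OF c(2)]
  have SM: "?S * ?M = four_block_mat M21 M22 M11 M12"
    using M by (subst mult_four_block_mat[of _ p a _ p _ a _ _ b _ m]) auto
  have SMT: "four_block_mat M21 M22 M11 M12 * ?T = ?M'"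
    using M by (subst mult_four_block_mat[of _ p b _ m _ a _ _ m _ b]) auto
  have SE: "?S * (E @\<^sub>r F) = F @\<^sub>r E"
    using E by (subst four_block_mult_append_rows[of _ p a _ p _ a _ _ a]) auto
  have GT: "(G @\<^sub>c H) * ?T = H @\<^sub>c G"
    using G by (subst append_cols_mult_four_block[of _ b m _ b _ m _ _ b]) auto
  have "?U * four_block_mat ?M (E @\<^sub>r F) (G @\<^sub>c H) (0\<^sub>m b a)
      = four_block_mat (four_block_mat M21 M22 M11 M12) (F @\<^sub>r E) (G @\<^sub>c H) (0\<^sub>m b a)"
    using M E G
    by (subst mult_four_block_mat[of _ "p + a" "a + p" _ b _ b _ _ "b + m" _ a]) (auto simp: SM SE c0)
  moreover have "four_block_mat (four_block_mat M21 M22 M11 M12) (F @\<^sub>r E) (G @\<^sub>c H) (0\<^sub>m b a) * ?V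
      = four_block_mat ?M' (F @\<^sub>r E) (H @\<^sub>c G) (0\<^sub>m b a)"
    using M E G
    by (subst mult_four_block_mat[of _ "p + a" "b + m" _ a _ b _ _ "m + b" _ a]) (auto simp: SMT GT c0)
  moreover have "four_block_mat ?M' (F @\<^sub>r E) (H @\<^sub>c G) (0\<^sub>m b a)
      = four_block_mat M22 (M21 @\<^sub>c F) (M12 @\<^sub>r H) (four_block_mat M11 E G (0\<^sub>m b a))"
    using M E G by (intro eq_matI) (auto simp: append_rows_def append_cols_def)
  ultimately show "?U * ((M11 @\<^sub>c M12 @\<^sub>c E) @\<^sub>r (M21 @\<^sub>c M22 @\<^sub>c F) @\<^sub>r (G @\<^sub>c H @\<^sub>c 0\<^sub>m b a)) * ?V
      = four_block_mat M22 (M21 @\<^sub>c F) (M12 @\<^sub>r H) (four_block_mat M11 E G (0\<^sub>m b a))"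
    unfolding L by simp
  show "?U \<in> carrier_mat (p + (a + b)) (p + (a + b))" "unimodular ?U"
    using swap_unimodular[of p a b] by (simp_all add: add.assoc)
  show "?V \<in> carrier_mat (m + (a + b)) (m + (a + b))" "unimodular ?V"
    using swap_unimodular[of b m a] by (simp_all add: add_ac)
qed

section \<open>Block Kronecker pencils as linearizations\<close>

theorem theorem6p2:
  fixes \<epsilon> \<eta> p m :: nat
    and M1 M0 :: "'a :: field mat"
    and CK P M11 M12 M21 M22 A\<epsilon> B\<epsilon> A\<eta> B\<eta> A B C D :: "'a poly mat"
  assumes "p \<ge> 1" and "m \<ge> 1"
    and "M1 \<in> carrier_mat ((\<eta> + 1) * p) ((\<epsilon> + 1) * m)"
    and "M0 \<in> carrier_mat ((\<eta> + 1) * p) ((\<epsilon> + 1) * m)"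
    and CK: "CK = block_kronecker_pencil \<epsilon> \<eta> p m M1 M0"
    and P: "P = block_kronecker_poly \<epsilon> \<eta> p m M1 M0"
    and "A\<epsilon> \<in> carrier_mat (\<epsilon> * m) (\<epsilon> * m)" and "B\<epsilon> \<in> carrier_mat (\<epsilon> * m) m"
    and "L_pencil \<epsilon> \<otimes>\<^sub>K 1\<^sub>m m = A\<epsilon> @\<^sub>c B\<epsilon>"
    and "A\<eta> \<in> carrier_mat (\<eta> * p) (\<eta> * p)" and "B\<eta> \<in> carrier_mat (\<eta> * p) p"
    and "L_pencil \<eta> \<otimes>\<^sub>K 1\<^sub>m p = A\<eta> @\<^sub>c B\<eta>"
    and "M11 \<in> carrier_mat (\<eta> * p) (\<epsilon> * m)" and "M12 \<in> carrier_mat (\<eta> * p) m"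
    and "M21 \<in> carrier_mat p (\<epsilon> * m)" and "M22 \<in> carrier_mat p m"
    and "CK = (M11 @\<^sub>c M12 @\<^sub>c A\<eta>\<^sup>T) @\<^sub>r
              (M21 @\<^sub>c M22 @\<^sub>c B\<eta>\<^sup>T) @\<^sub>r
              (A\<epsilon> @\<^sub>c B\<epsilon> @\<^sub>c 0\<^sub>m (\<epsilon> * m) (\<eta> * p))"
    and A: "A = four_block_mat M11 (A\<eta>\<^sup>T) A\<epsilon> (0\<^sub>m (\<epsilon> * m) (\<eta> * p))"
    and B: "B = M12 @\<^sub>r B\<epsilon>"
    and C: "C = - (M21 @\<^sub>c B\<eta>\<^sup>T)"
    and D: "D = M22"
  shows "unimodular A \<and>
         (invertible_mat A \<and> schur_complement A B C D = P) \<and>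
         is_linearization CK P"
proof -
  note Ac = assms(7-12) and Mc = assms(13-16)
  let ?s = "\<eta> * p + \<epsilon> * m"
  obtain E\<epsilon> where E\<epsilon>: "E\<epsilon> \<in> carrier_mat (\<epsilon> * m) (\<epsilon> * m)" "A\<epsilon> * E\<epsilon> = 1\<^sub>m (\<epsilon> * m)" "E\<epsilon> * A\<epsilon> = 1\<^sub>m (\<epsilon> * m)"
    using L_kronecker_left_block_inverse[OF Ac(1-3)] by blast
  obtain E where E: "E \<in> carrier_mat (\<eta> * p) (\<eta> * p)" "A\<eta> * E = 1\<^sub>m (\<eta> * p)" "E * A\<eta> = 1\<^sub>m (\<eta> * p)"
    using L_kronecker_left_block_inverse[OF Ac(4-6)] by blast
  define E\<eta> where "E\<eta> = E\<^sup>T"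
  have E\<eta>: "E\<eta> \<in> carrier_mat (\<eta> * p) (\<eta> * p)" "A\<eta>\<^sup>T * E\<eta> = 1\<^sub>m (\<eta> * p)" "E\<eta> * A\<eta>\<^sup>T = 1\<^sub>m (\<eta> * p)"
    using E(1) arg_cong[OF E(3), of transpose_mat] arg_cong[OF E(2), of transpose_mat]
      transpose_mult[OF E(1) Ac(4)] transpose_mult[OF Ac(4) E(1)]
    by (simp_all add: E\<eta>_def)
  have AT: "A\<eta>\<^sup>T \<in> carrier_mat (\<eta> * p) (\<eta> * p)" "B\<eta>\<^sup>T \<in> carrier_mat p (\<eta> * p)"
    using Ac by auto
  obtain A' where A': "A' \<in> carrier_mat ?s ?s" "A * A' = 1\<^sub>m ?s" "A' * A = 1\<^sub>m ?s"
    using anti_triangular_block_inverse[OF Mc(1) AT(1) E\<eta> Ac(1) E\<epsilon>] unfolding A by blast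
  have Ac': "A \<in> carrier_mat ?s ?s"
    using Mc Ac AT unfolding A by (auto simp: add.commute)
  have uA: "unimodular A" by (rule unimodular_if_right_inverse[OF Ac' A'(1,2)])
  have iA: "invertible_mat A"
    using Ac' A' by (auto simp: invertible_mat_def inverts_mat_def)

  obtain X :: "'a poly mat" where X: "X \<in> carrier_mat (\<epsilon> * m) m" "Lambda_vec \<epsilon> \<otimes>\<^sub>K 1\<^sub>m m = X @\<^sub>r 1\<^sub>m m"
    using Lambda_kronecker_split by blast
  obtain Y :: "'a poly mat" where Y: "Y \<in> carrier_mat (\<eta> * p) p" "Lambda_vec \<eta> \<otimes>\<^sub>K 1\<^sub>m p = Y @\<^sub>r 1\<^sub>m p"
    using Lambda_kronecker_split by blast
  have AX: "A\<epsilon> * (- X) = B\<epsilon>" by (rule L_kronecker_annihilates[OF Ac(1-3) X])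
  have AY: "A\<eta> * (- Y) = B\<eta>" by (rule L_kronecker_annihilates[OF Ac(4-6) Y])

  \<comment> \<open>\<open>N\<close> is the upper block of \<open>(\<lambda>M\<^sub>1 + M\<^sub>0)(\<Lambda>\<^sub>\<epsilon> \<otimes> I)\<close>; it appears both in the solution of
    \<open>A Z = B\<close> and in the expansion of \<open>P\<close>.\<close>
  define N where "N = M11 * X + M12"
  have Nc: "N \<in> carrier_mat (\<eta> * p) m" using Mc X by (auto simp: N_def)
  define W where "W = E\<eta> * N"
  have Wc: "W \<in> carrier_mat (\<eta> * p) m" using Nc E\<eta> by (auto simp: W_def)
  have AW: "A\<eta>\<^sup>T * W = N"
    using AT E\<eta> Nc by (simp add: W_def flip: assoc_mult_mat[of _ "\<eta> * p" "\<eta> * p" _ "\<eta> * p" _ m])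
  let ?Z = "(- X) @\<^sub>r W"
  have Zc: "?Z \<in> carrier_mat ?s m" using X Wc by (auto simp: add.commute)
  have "M11 * (- X) + N = M12"
    using Mc X by (auto simp: N_def intro!: eq_matI)
  then have AZ: "A * ?Z = B"
    unfolding A B using Mc Ac AT X Wc
    by (subst four_block_mult_append_rows[of _ "\<eta> * p" "\<epsilon> * m" _ "\<eta> * p" _ "\<epsilon> * m" _ _ m]) (auto simp: AW AX)
  have Cc: "C \<in> carrier_mat p ?s"
    using Mc AT unfolding C by (auto simp: add.commute)
  have Bc: "B \<in> carrier_mat ?s m"
    using Mc Ac unfolding B by auto

  have "B\<eta>\<^sup>T = (- Y)\<^sup>T * A\<eta>\<^sup>T"
    unfolding AY[symmetric] using Ac Y by (intro transpose_mult) auto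
  also have "(- Y)\<^sup>T = - Y\<^sup>T" by (rule eq_matI) auto
  finally have "B\<eta>\<^sup>T * W = (- Y\<^sup>T) * A\<eta>\<^sup>T * W" by simp
  also have "\<dots> = (- Y\<^sup>T) * N"
    using Y AT Wc by (simp only: AW[symmetric] assoc_mult_mat[of _ p "\<eta> * p" _ "\<eta> * p" _ m] uminus_carrier_iff_mat transpose_carrier_mat)
  also have "\<dots> = - (Y\<^sup>T * N)" using Y Nc by simp
  finally have BW: "B\<eta>\<^sup>T * W = - (Y\<^sup>T * N)" .
  have "C * ?Z = - ((M21 @\<^sub>c B\<eta>\<^sup>T) * ?Z)"
    unfolding C using Mc AT Zc by (intro uminus_mult_left_mat) (auto simp: append_rows_def append_cols_def)
  also have "(M21 @\<^sub>c B\<eta>\<^sup>T) * ?Z = - (M21 * X) + - (Y\<^sup>T * N)"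
    using Mc AT X Wc by (subst append_cols_mult_append_rows[of _ p "\<epsilon> * m" _ "\<eta> * p" _ m]) (auto simp: BW)
  finally have CZ: "C * ?Z = - (- (M21 * X) + - (Y\<^sup>T * N))" .

  have pen: "pencil M1 M0 \<in> carrier_mat ((\<eta> + 1) * p) ((\<epsilon> + 1) * m)"
    using assms(3,4) by (auto simp: pencil_def)
  \<comment> \<open>The prescribed \<open>3 \<times> 3\<close> partition of \<open>C\<^sub>K\<close> partitions its upper left block as well.\<close>
  have M: "pencil M1 M0 = four_block_mat M11 M12 M21 M22"
  proof (rule eq_matI)
    fix i j assume "i < dim_row (four_block_mat M11 M12 M21 M22)" "j < dim_col (four_block_mat M11 M12 M21 M22)"
    then have ij: "i < \<eta> * p + p" "j < \<epsilon> * m + m" using Mc by auto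
    then have "pencil M1 M0 $$ (i, j) = CK $$ (i, j)"
      using pen by (simp add: CK block_kronecker_pencil_def L_pencil_def add.commute)
    also have "\<dots> = four_block_mat M11 M12 M21 M22 $$ (i, j)"
      using ij Mc Ac AT unfolding assms(17) by (auto simp: append_rows_def append_cols_def)
    finally show "pencil M1 M0 $$ (i, j) = four_block_mat M11 M12 M21 M22 $$ (i, j)" .
  qed (use pen Mc in auto)
  have LT: "(Lambda_vec \<eta>)\<^sup>T \<otimes>\<^sub>K 1\<^sub>m p = Y\<^sup>T @\<^sub>c (1\<^sub>m p :: 'a poly mat)"
  proof -
    have "(Lambda_vec \<eta>)\<^sup>T \<otimes>\<^sub>K 1\<^sub>m p = (Lambda_vec \<eta> \<otimes>\<^sub>K (1\<^sub>m p :: 'a poly mat))\<^sup>T"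
      by (simp add: kronecker_transpose transpose_one)
    also have "\<dots> = Y\<^sup>T @\<^sub>c 1\<^sub>m p"
      unfolding Y(2) using Y(1) by (simp add: append_rows_transpose[of _ "\<eta> * p" p _ p] transpose_one)
    finally show ?thesis .
  qed
  have c: "Y\<^sup>T @\<^sub>c 1\<^sub>m p \<in> carrier_mat p (\<eta> * p + p)" "X @\<^sub>r 1\<^sub>m m \<in> carrier_mat (\<epsilon> * m + m) m"
    "four_block_mat M11 M12 M21 M22 \<in> carrier_mat (\<eta> * p + p) (\<epsilon> * m + m)"
    using X Y Mc by auto
  have "P = (Y\<^sup>T @\<^sub>c 1\<^sub>m p) * (four_block_mat M11 M12 M21 M22 * (X @\<^sub>r 1\<^sub>m m))"
    unfolding P block_kronecker_poly_def LT X(2) M by (rule assoc_mult_mat[OF c(1,3,2)])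
  also have "four_block_mat M11 M12 M21 M22 * (X @\<^sub>r 1\<^sub>m m) = N @\<^sub>r (M21 * X + M22)"
    unfolding N_def using Mc X
    by (subst four_block_mult_append_rows[of _ "\<eta> * p" "\<epsilon> * m" _ m _ p _ _ m]) auto
  also have "(Y\<^sup>T @\<^sub>c 1\<^sub>m p) * (N @\<^sub>r (M21 * X + M22)) = Y\<^sup>T * N + (M21 * X + M22)"
    using Mc X Y Nc by (subst append_cols_mult_append_rows[of _ p "\<eta> * p" _ p _ m]) auto
  finally have P_eq: "P = Y\<^sup>T * N + (M21 * X + M22)" .
  have Pc: "P \<in> carrier_mat p m" using P_eq Mc X Y Nc by auto

  have "schur_complement A B C D = D + C * ?Z"
    by (rule schur_complement_by_solution[OF Ac' A' Cc Zc AZ])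
  also have "\<dots> = P"
    unfolding CZ D P_eq using Mc X Y Nc by (intro eq_matI) (auto simp: algebra_simps)
  finally have schur: "schur_complement A B C D = P" .

  obtain U1 V1 where U1: "U1 \<in> carrier_mat (p + ?s) (p + ?s)" "unimodular U1"
    and V1: "V1 \<in> carrier_mat (m + ?s) (m + ?s)" "unimodular V1"
    and eq1: "U1 * CK * V1 = four_block_mat M22 (M21 @\<^sub>c B\<eta>\<^sup>T) B A"
    unfolding assms(17) A B using middle_block_to_front[OF Mc AT Ac(1,2)] by metis
  have D': "D \<in> carrier_mat p m" using Mc D by simp
  obtain U2 V2 where U2: "U2 \<in> carrier_mat (p + ?s) (p + ?s)" "unimodular U2"
    and V2: "V2 \<in> carrier_mat (m + ?s) (m + ?s)" "unimodular V2"
    and eq2: "U2 * four_block_mat D (- C) B A * V2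
      = four_block_mat P (0\<^sub>m p ?s) (0\<^sub>m ?s m) (1\<^sub>m ?s)"
    using schur_reduction[OF Ac' A' Bc Cc D'] unfolding schur by metis
  have mC: "- C = M21 @\<^sub>c B\<eta>\<^sup>T" unfolding C by simp
  have CKc: "CK \<in> carrier_mat (p + ?s) (m + ?s)"
    unfolding CK block_kronecker_pencil_def using pen by (auto simp: L_pencil_def)
  have "U2 * U1 * CK * (V1 * V2) = U2 * (U1 * CK * V1) * V2"
    using U1(1) U2(1) V1(1) V2(1) CKc
    by (simp add: assoc_mult_mat[of _ "p + ?s" "p + ?s" _ "p + ?s" _ "m + ?s"]
        assoc_mult_mat[of _ "p + ?s" "p + ?s" _ "m + ?s" _ "m + ?s"]
        assoc_mult_mat[of _ "p + ?s" "m + ?s" _ "m + ?s" _ "m + ?s"])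
  also have "\<dots> = four_block_mat P (0\<^sub>m p ?s) (0\<^sub>m ?s m) (1\<^sub>m ?s)"
    using eq1 eq2 by (simp add: mC D)
  finally have eq: "U2 * U1 * CK * (V1 * V2)
    = four_block_mat P (0\<^sub>m (dim_row P) ?s) (0\<^sub>m ?s (dim_col P)) (1\<^sub>m ?s)"
    using Pc by simp
  have "is_pencil CK" unfolding CK by (rule block_kronecker_pencil_is_pencil[OF assms(3,4)])
  moreover have "unimodular (U2 * U1)" "unimodular (V1 * V2)"
    using U1 U2 V1 V2 unimodular_mult by blast+
  moreover have "U2 * U1 \<in> carrier_mat (dim_row CK) (dim_row CK)"
    "V1 * V2 \<in> carrier_mat (dim_col CK) (dim_col CK)"
    using U1 U2 V1 V2 CKc by auto
  ultimately have "is_linearization CK P"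
    unfolding is_linearization_def using eq by blast
  then show ?thesis using uA iA schur by blast
qed

end
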